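(* Fix a prime $p$, an integer $d\ge2$, $a\in\mathbb{Q}^*$, and $b\in\mathcal{P}_0^+$, and let $\psi_{d,a,b}(z)=\frac{z}{az^d+b}$, viewed as a map $\mathbb{P}^1\to\mathbb{P}^1$. (a) If $d$ is odd, then every rational periodic point of $\psi_{d,a,b}$ is fixed. (b) If $d$ is even, then every rational periodic cycle of $\psi_{d,a,b}$ has length at most $2$, and any rational periodic cycle of length $2$ is of the form $\{z,-z\}$, i.e. $\psi_{d,a,b}(z)=-z$ and $\psi_{d,a,b}(-z)=z$.
   Context: $\mathcal{P}_0^+:=\{\sigma p^e:\sigma\in\{\pm1\},\ e\in\mathbb{Z},\ e\ge0\}$. In homogeneous coordinates $\psi_{d,a,b}([X,Y]) = [XY^{d-1}, aX^d+bY^d]$. A rational periodic point is a point of $\mathbb{P}^1(\mathbb{Q})$ with $\psi^n(P)=P$ for some $n\ge1$; a rational periodic cycle of length $n$ is the orbit of a rational periodic point of exact period $n$. *)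

theory Defs
  imports Complex_Main "HOL-Computational_Algebra.Primes"
begin

text \<open>The points of the projective line over a field: pairs of homogeneous coordinates,
  not both zero, up to multiplication by a nonzero scalar.\<close>

definition proj_rel :: "'a::field \<times> 'a \<Rightarrow> 'a \<times> 'a \<Rightarrow> bool" where
  "proj_rel u v \<longleftrightarrow> u \<noteq> (0, 0) \<and> v \<noteq> (0, 0) \<and>
     (\<exists>c. c \<noteq> 0 \<and> fst v = c * fst u \<and> snd v = c * snd u)"

quotient_type (overloaded) 'a proj_line = "'a::field \<times> 'a" / partial: proj_rel
proof (rule part_equivpI)
  show "\<exists>u :: 'a \<times> 'a. proj_rel u u"
    by (rule exI[of _ "(1, 0)"]) (auto simp: proj_rel_def intro: exI[of _ 1])
  show "symp (proj_rel :: 'a \<times> 'a \<Rightarrow> _)"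
  proof (rule sympI)
    fix u v :: "'a \<times> 'a" assume "proj_rel u v"
    then obtain c where "u \<noteq> (0, 0)" "v \<noteq> (0, 0)" "c \<noteq> 0"
        "fst v = c * fst u" "snd v = c * snd u"
      by (auto simp: proj_rel_def)
    then show "proj_rel v u"
      unfolding proj_rel_def by (intro conjI exI[of _ "inverse c"]) auto
  qed
  show "transp (proj_rel :: 'a \<times> 'a \<Rightarrow> _)"
  proof (rule transpI)
    fix u v w :: "'a \<times> 'a" assume "proj_rel u v" "proj_rel v w"
    then obtain c e where "u \<noteq> (0, 0)" "w \<noteq> (0, 0)" "c \<noteq> 0" "e \<noteq> 0"
        "fst v = c * fst u" "snd v = c * snd u" "fst w = e * fst v" "snd w = e * snd v"
      by (auto simp: proj_rel_def)
    then show "proj_rel u w"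
      unfolding proj_rel_def by (intro conjI exI[of _ "e * c"]) auto
  qed
qed

lift_definition affine_pt :: "'a::field \<Rightarrow> 'a proj_line" is "\<lambda>z. (z, 1)"
  by (auto simp: proj_rel_def intro: exI[of _ 1])

lift_definition infinity_pt :: "'a::field proj_line" is "(1, 0)"
  by (auto simp: proj_rel_def intro: exI[of _ 1])

text \<open>The map \<open>[X, Y] \<mapsto> [X Y^(d-1), a X^d + b Y^d]\<close>. It is a well-defined
  self-map of the projective line when \<open>d \<ge> 2\<close> and \<open>a\<close>, \<open>b\<close> are nonzero; for
  other parameters the value is irrelevant and set to \<open>[0, 1]\<close>.\<close>

lift_definition psi :: "nat \<Rightarrow> 'a::field \<Rightarrow> 'a \<Rightarrow> 'a proj_line \<Rightarrow> 'a proj_line" is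
  "\<lambda>d a b (X, Y). if d \<ge> 2 \<and> a \<noteq> 0 \<and> b \<noteq> 0
      then (X * Y ^ (d - 1), a * X ^ d + b * Y ^ d) else (0, 1)"
proof -
  fix d :: nat and a b :: 'a and u v :: "'a \<times> 'a"
  assume rel: "proj_rel u v"
  let ?f = "\<lambda>(X, Y). if d \<ge> 2 \<and> a \<noteq> 0 \<and> b \<noteq> 0
      then (X * Y ^ (d - 1), a * X ^ d + b * Y ^ d) else (0, 1 :: 'a)"
  show "proj_rel (?f u) (?f v)"
  proof (cases "d \<ge> 2 \<and> a \<noteq> 0 \<and> b \<noteq> 0")
    case True
    obtain X Y where u: "u = (X, Y)" by (cases u)
    from rel u obtain c where c: "c \<noteq> 0" "v = (c * X, c * Y)" and ne: "X \<noteq> 0 \<or> Y \<noteq> 0"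
      by (cases v) (auto simp: proj_rel_def)
    have pw: "c ^ d = c * c ^ (d - 1)"
      using True by (cases d) auto
    have nz: "(S * T ^ (d - 1), a * S ^ d + b * T ^ d) \<noteq> (0, 0)"
      if "S \<noteq> 0 \<or> T \<noteq> 0" for S T :: 'a
      using that True by (cases "S = 0") (auto simp: power_0_left)
    have n1: "?f u \<noteq> (0, 0)" and n2: "?f v \<noteq> (0, 0)"
      using nz[of X Y] nz[of "c * X" "c * Y"] ne c True by (auto simp: u)
    have "fst (?f v) = c ^ d * fst (?f u)" "snd (?f v) = c ^ d * snd (?f u)"
      using True pw by (auto simp: u c power_mult_distrib algebra_simps)
    then show ?thesis
      using n1 n2 c(1) unfolding proj_rel_def by (intro conjI exI[of _ "c ^ d"]) auto
  next
    case False
    then show ?thesis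
      by (cases u; cases v) (auto simp: proj_rel_def intro: exI[of _ 1])
  qed
qed

lemma psi_affine_pt:
  assumes "d \<ge> 2" "a \<noteq> 0" "b \<noteq> 0" "a * z ^ d + b \<noteq> 0"
  shows "psi d a b (affine_pt z) = affine_pt (z / (a * z ^ d + b))"
  using assms
proof transfer
  fix d :: nat and a b z :: 'a
  assume "d \<ge> 2" "a \<noteq> 0" "b \<noteq> 0" and nz: "a * z ^ d + b \<noteq> 0"
  moreover have "proj_rel (z, a * z ^ d + b) (z / (a * z ^ d + b), 1)"
    unfolding proj_rel_def using nz
    by (intro conjI exI[of _ "inverse (a * z ^ d + b)"]) (simp_all add: divide_inverse)
  ultimately show "proj_rel (case (z, 1) of (X, Y) \<Rightarrow> if d \<ge> 2 \<and> a \<noteq> 0 \<and> b \<noteq> 0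
      then (X * Y ^ (d - 1), a * X ^ d + b * Y ^ d) else (0, 1)) (z / (a * z ^ d + b), 1)"
    by simp
qed

lemma psi_pole:
  assumes "d \<ge> 2" "a \<noteq> 0" "b \<noteq> 0" "a * z ^ d + b = 0"
  shows "psi d a b (affine_pt z) = infinity_pt"
  using assms
proof transfer
  fix d :: nat and a b z :: 'a
  assume *: "d \<ge> 2" "a \<noteq> 0" "b \<noteq> 0" "a * z ^ d + b = 0"
  then have "z \<noteq> 0" by (auto simp: power_0_left)
  then have "proj_rel (z, 0) (1, 0)"
    unfolding proj_rel_def by (intro conjI exI[of _ "inverse z"]) simp_all
  with * show "proj_rel (case (z, 1) of (X, Y) \<Rightarrow> if d \<ge> 2 \<and> a \<noteq> 0 \<and> b \<noteq> 0
      then (X * Y ^ (d - 1), a * X ^ d + b * Y ^ d) else (0, 1)) (1, 0)"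
    by simp
qed

lemma psi_infinity_pt:
  assumes "d \<ge> 2" "a \<noteq> 0" "b \<noteq> 0"
  shows "psi d a b infinity_pt = affine_pt 0"
  using assms
proof transfer
  fix d :: nat and a b :: 'a
  assume *: "d \<ge> 2" "a \<noteq> 0" "b \<noteq> 0"
  then have "proj_rel (0, a) (0, 1)"
    unfolding proj_rel_def by (intro conjI exI[of _ "inverse a"]) simp_all
  with * show "proj_rel (case (1, 0) of (X, Y) \<Rightarrow> if d \<ge> 2 \<and> a \<noteq> 0 \<and> b \<noteq> 0
      then (X * Y ^ (d - 1), a * X ^ d + b * Y ^ d) else (0, 1)) (0, 1)"
    by (simp add: power_0_left)
qed

definition signed_powers :: "nat \<Rightarrow> rat set" where
  "signed_powers p = {\<sigma> * of_nat p ^ e | \<sigma> e. \<sigma> \<in> {1, -1}}"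

definition periodic_point :: "('b \<Rightarrow> 'b) \<Rightarrow> 'b \<Rightarrow> bool" where
  "periodic_point f P \<longleftrightarrow> (\<exists>n\<ge>1. (f ^^ n) P = P)"

definition exact_period :: "('b \<Rightarrow> 'b) \<Rightarrow> 'b \<Rightarrow> nat \<Rightarrow> bool" where
  "exact_period f P n \<longleftrightarrow> n \<ge> 1 \<and> (f ^^ n) P = P \<and> (\<forall>m. 1 \<le> m \<and> m < n \<longrightarrow> (f ^^ m) P \<noteq> P)"

definition periodic_cycle :: "('b \<Rightarrow> 'b) \<Rightarrow> nat \<Rightarrow> 'b set \<Rightarrow> bool" where
  "periodic_cycle f n C \<longleftrightarrow> (\<exists>P. exact_period f P n \<and> C = {(f ^^ k) P | k. True})"

end

theory Submission
  imports Defs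
begin

text \<open>
  In the coordinate \<open>w = 1/z\<close> the map reads \<open>w \<mapsto> b w + a / w^(d-1)\<close>. Along a cycle of
  nonzero points put \<open>t = a / w^d\<close>, so that \<open>w' / w = b + t\<close> and \<open>t' = t / (b + t)^d\<close>.
  At a prime \<open>q\<close> where \<open>b\<close> is a unit, a pole of \<open>t\<close> would make \<open>t'\<close> and all later values
  vanish mod \<open>q\<close>, so \<open>t\<close> is \<open>q\<close>-integral and the ratios \<open>b + t\<close>, whose product over the cycle
  is 1, are \<open>q\<close>-units. Hence two points of the cycle differ by a factor \<open>\<plusminus>p^k\<close>, with \<open>k = 0\<close>
  if \<open>\<bar>b\<bar> = 1\<close>. If \<open>\<bar>b\<bar> \<ge> 2\<close> and \<open>\<bar>w\<bar>\<close> is not constant, the maximum of \<open>\<bar>w\<bar>\<close> is at least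
  twice its minimum, and comparing \<open>w^(d-1) (w' - b w) = a\<close> at both shows that a point of
  maximal \<open>\<bar>w\<bar>\<close> is followed by another one, which is absurd. So \<open>\<bar>w\<bar>\<close> is constant, and only
  signs are left to analyse.
\<close>

section \<open>Localization of the integers at a prime\<close>

text \<open>Membership in this ring and in the maximal ideal \<open>local_ideal q\<close> plays the
  role of the conditions v \<ge> 0 and v > 0 for the \<open>q\<close>-adic valuation v.\<close>

definition local_ring :: "int \<Rightarrow> rat set" where
  "local_ring q = {of_int x / of_int y | x y. \<not> q dvd y}"

definition local_ideal :: "int \<Rightarrow> rat set" where
  "local_ideal q = {of_int q * r | r. r \<in> local_ring q}"

lemma local_ringI: "\<not> q dvd y \<Longrightarrow> of_int x / of_int y \<in> local_ring q"
  by (auto simp: local_ring_def)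

lemma local_ringE:
  assumes "r \<in> local_ring q"
  obtains x y where "r = of_int x / of_int y" "\<not> q dvd y" "y \<noteq> 0"
  using assms by (auto simp: local_ring_def)

lemma local_idealI:
  assumes "q dvd x" "\<not> q dvd y"
  shows "of_int x / of_int y \<in> local_ideal q"
proof -
  obtain k where "x = q * k" using assms by (elim dvdE)
  then have "of_int x / of_int y = of_int q * (of_int k / of_int y :: rat)" by simp
  then show ?thesis unfolding local_ideal_def using local_ringI[OF assms(2)] by blast
qed

context
  fixes q :: int
  assumes q: "prime q"
begin

lemma local_ring_of_int: "of_int x \<in> local_ring q"
  using local_ringI[of q 1 x] q by auto

lemma local_ring_1: "1 \<in> local_ring q"
  using local_ring_of_int[of 1] by simp

lemma local_ring_mult:
  assumes "r \<in> local_ring q" "s \<in> local_ring q"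
  shows "r * s \<in> local_ring q"
proof -
  obtain x y where 1: "r = of_int x / of_int y" "\<not> q dvd y"
    using assms by (auto elim: local_ringE)
  obtain x' y' where 2: "s = of_int x' / of_int y'" "\<not> q dvd y'"
    using assms by (auto elim: local_ringE)
  have "\<not> q dvd y * y'" using 1 2 q by (simp add: prime_dvd_mult_iff)
  from local_ringI[OF this, of "x * x'"] show ?thesis by (simp add: 1 2)
qed

lemma local_ring_add:
  assumes "r \<in> local_ring q" "s \<in> local_ring q"
  shows "r + s \<in> local_ring q"
proof -
  obtain x y where 1: "r = of_int x / of_int y" "\<not> q dvd y" "y \<noteq> 0"
    using assms by (auto elim: local_ringE)
  obtain x' y' where 2: "s = of_int x' / of_int y'" "\<not> q dvd y'" "y' \<noteq> 0"
    using assms by (auto elim: local_ringE)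
  have "\<not> q dvd y * y'" using 1 2 q by (simp add: prime_dvd_mult_iff)
  from local_ringI[OF this, of "x * y' + x' * y"] show ?thesis
    using 1(3) 2(3) by (simp add: 1(1) 2(1) add_frac_eq)
qed

lemma local_ring_power: "r \<in> local_ring q \<Longrightarrow> r ^ n \<in> local_ring q"
  by (induction n) (auto intro: local_ring_mult local_ring_1)

lemma local_ring_prod:
  "(\<And>i. i \<in> A \<Longrightarrow> f i \<in> local_ring q) \<Longrightarrow> prod f A \<in> local_ring q"
  by (induction A rule: infinite_finite_induct) (auto intro: local_ring_mult local_ring_1)

lemma local_ideal_mult:
  "r \<in> local_ideal q \<Longrightarrow> s \<in> local_ring q \<Longrightarrow> r * s \<in> local_ideal q"
  unfolding local_ideal_def by (auto simp: mult.assoc intro: local_ring_mult)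

lemma local_ideal_add:
  "r \<in> local_ideal q \<Longrightarrow> s \<in> local_ideal q \<Longrightarrow> r + s \<in> local_ideal q"
  unfolding local_ideal_def by (auto simp flip: distrib_left intro!: local_ring_add)

lemma local_ideal_subset: "local_ideal q \<subseteq> local_ring q"
  unfolding local_ideal_def by (auto intro: local_ring_mult local_ring_of_int)

lemma one_notin_local_ideal: "1 \<notin> local_ideal q"
proof
  assume "1 \<in> local_ideal q"
  then obtain x y where xy: "1 = of_int q * (of_int x / of_int y :: rat)" "\<not> q dvd y" "y \<noteq> 0"
    unfolding local_ideal_def by (auto elim!: local_ringE)
  then have "(of_int y :: rat) = of_int (q * x)" by (simp add: field_simps)
  then have "y = q * x" using of_int_eq_iff by blast
  with xy show False by simp
qed

lemma inverse_in_local_ring: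
  assumes "r \<in> local_ring q" "r \<notin> local_ideal q"
  shows "inverse r \<in> local_ring q"
proof -
  obtain x y where xy: "r = of_int x / of_int y" "\<not> q dvd y"
    using assms by (auto elim: local_ringE)
  then have "\<not> q dvd x" using assms local_idealI by blast
  from local_ringI[OF this, of y] show ?thesis by (simp add: xy)
qed

text \<open>The valuation ring dichotomy: in lowest terms, if \<open>q\<close> divides the
  denominator it cannot divide the numerator.\<close>

lemma inverse_in_local_ideal:
  assumes "r \<notin> local_ring q"
  shows "inverse r \<in> local_ideal q"
proof -
  obtain x y where xy: "quotient_of r = (x, y)" by (cases "quotient_of r")
  then have r: "r = of_int x / of_int y" and cop: "coprime x y"
    by (auto simp: quotient_of_div quotient_of_coprime)
  have "q dvd y" using assms r local_ringI by blast
  moreover from this have "\<not> q dvd x" using cop q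
    by (meson coprime_common_divisor not_prime_unit)
  ultimately show ?thesis using local_idealI[of q y x] by (simp add: r)
qed

text \<open>If the sum of a unit and an ideal element were in the ideal, the unit would be too, and
  hence also 1.\<close>

lemma local_unit_add:
  assumes "u \<in> local_ring q" "inverse u \<in> local_ring q" "u \<noteq> 0" "r \<in> local_ideal q"
  shows "inverse (u + r) \<in> local_ring q"
proof (rule inverse_in_local_ring)
  show "u + r \<in> local_ring q" using assms local_ideal_subset local_ring_add by blast
  show "u + r \<notin> local_ideal q"
  proof
    assume "u + r \<in> local_ideal q"
    moreover have "- r \<in> local_ideal q"
      using local_ideal_mult[OF assms(4) local_ring_of_int[of "-1"]] by simp
    ultimately have "u \<in> local_ideal q" using local_ideal_add by fastforce
    then have "u * inverse u \<in> local_ideal q" using assms local_ideal_mult by blast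
    then show False using assms one_notin_local_ideal by simp
  qed
qed

end

section \<open>Rationals that are units at all primes, or at all primes but one\<close>

lemma not_dvd_quotient_of:
  assumes "prime q" "r \<in> local_ring q" "quotient_of r = (x, y)"
  shows "\<not> q dvd y"
proof
  assume dvd: "q dvd y"
  obtain x' y' where xy: "r = of_int x' / of_int y'" "\<not> q dvd y'" "y' \<noteq> 0"
    using assms by (auto elim: local_ringE)
  have r: "r = of_int x / of_int y" "coprime x y" "y > 0"
    using assms by (auto simp: quotient_of_div quotient_of_coprime quotient_of_denom_pos)
  then have "(of_int (x * y') :: rat) = of_int (x' * y)"
    using xy by (simp add: field_simps)
  then have "x * y' = x' * y" using of_int_eq_iff by blast
  then have "q dvd x * y'" using dvd by simp
  then have "q dvd x" using xy assms(1) by (simp add: prime_dvd_mult_iff)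
  then show False using dvd r(2) assms(1)
    by (meson coprime_common_divisor not_prime_unit)
qed

lemma not_dvd_quotient_of_inverse:
  assumes "prime q" "inverse r \<in> local_ring q" "r \<noteq> 0" "quotient_of r = (x, y)"
  shows "\<not> q dvd x"
proof
  assume "q dvd x"
  have r: "r = of_int x / of_int y" "coprime x y" "y > 0"
    using assms by (auto simp: quotient_of_div quotient_of_coprime quotient_of_denom_pos)
  then have "\<not> q dvd y" using \<open>q dvd x\<close> assms(1)
    by (meson coprime_common_divisor not_prime_unit)
  then have "r \<in> local_ideal q" using r \<open>q dvd x\<close> local_idealI by blast
  then have "r * inverse r \<in> local_ideal q" using assms local_ideal_mult by blast
  then show False using assms one_notin_local_ideal by simp
qed

lemma abs_eq_1_if_local_unit:
  assumes "r \<noteq> 0"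
    and "\<And>q. prime q \<Longrightarrow> r \<in> local_ring q" "\<And>q. prime q \<Longrightarrow> inverse r \<in> local_ring q"
  shows "\<bar>r\<bar> = 1"
proof -
  obtain x y where xy: "quotient_of r = (x, y)" by (cases "quotient_of r")
  have "is_unit x" "is_unit y"
    using assms not_dvd_quotient_of[OF _ _ xy] not_dvd_quotient_of_inverse[OF _ _ _ xy]
    by (metis prime_divisorE quotient_of_denom_pos xy quotient_of_div div_0 of_int_0 less_irrefl)+
  then have "\<bar>x\<bar> = 1" "\<bar>y\<bar> = 1" by auto
  moreover have "\<bar>r\<bar> = of_int \<bar>x\<bar> / of_int \<bar>y\<bar>" using quotient_of_div[OF xy] by simp
  ultimately show ?thesis by simp
qed

text \<open>In lowest terms the numerator exceeds the denominator in absolute value, so it has a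
  prime divisor, which can only be \<open>p\<close>. Then no prime is left for the denominator, and
  the number is an integer.\<close>

lemma abs_ge_2_if_local_unit:
  assumes p: "prime p" and r: "\<bar>r\<bar> > 1"
    and *: "\<And>q. prime q \<Longrightarrow> q \<noteq> p \<Longrightarrow> r \<in> local_ring q"
      "\<And>q. prime q \<Longrightarrow> q \<noteq> p \<Longrightarrow> inverse r \<in> local_ring q"
  shows "\<bar>r\<bar> \<ge> 2"
proof -
  obtain x y where xy: "quotient_of r = (x, y)" by (cases "quotient_of r")
  have r': "r = of_int x / of_int y" "coprime x y" "y > 0"
    using xy by (auto simp: quotient_of_div quotient_of_coprime quotient_of_denom_pos)
  have "r \<noteq> 0" using r by auto
  then have "x \<noteq> 0" using r' by auto
  have gt: "\<bar>x\<bar> > y"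
  proof -
    have "\<bar>of_int x :: rat\<bar> > of_int y" using r r' by (simp add: field_simps abs_divide)
    then show ?thesis by (metis of_int_abs of_int_less_iff)
  qed
  then have "\<not> is_unit x" using r' by auto
  then have "p dvd x"
    using * \<open>r \<noteq> 0\<close> \<open>x \<noteq> 0\<close> not_dvd_quotient_of_inverse[OF _ _ _ xy] by (metis prime_divisorE)
  then have "\<not> p dvd y" using r' p by (meson coprime_common_divisor not_prime_unit)
  then have "is_unit y"
    using * r' not_dvd_quotient_of[OF _ _ xy] by (metis prime_divisorE less_irrefl)
  then have "y = 1" using r' by auto
  then have "\<bar>x\<bar> \<ge> 2" using gt by simp
  then have "(of_int \<bar>x\<bar> :: rat) \<ge> 2" by linarith
  then show ?thesis using r' \<open>y = 1\<close> by simp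
qed

section \<open>Cycles in the reciprocal coordinate\<close>

text \<open>The sequence \<open>w\<close> lists the reciprocals of the orbit points, over all of
  \<open>nat\<close>, with \<open>n\<close> any period.\<close>

locale reciprocal_cycle =
  fixes d n :: nat and a b :: rat and w :: "nat \<Rightarrow> rat"
  assumes d: "d \<ge> 2" and a: "a \<noteq> 0" and b: "b \<noteq> 0" and n: "n \<ge> 1"
    and w_nz: "w i \<noteq> 0"
    and w_per: "w (i + n) = w i"
    and w_Suc: "w (Suc i) = b * w i + a / w i ^ (d - 1)"
begin

lemma w_per_mult: "w (i + k * n) = w i"
proof (induction k)
  case (Suc k)
  have "w (i + Suc k * n) = w ((i + k * n) + n)" by (simp add: algebra_simps)
  then show ?case using Suc w_per by simp
qed simp

lemma w_reach: "\<exists>k. w (i + k) = w j"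
proof
  \<comment> \<open>Adding \<open>i\<close> full turns keeps the truncated subtraction exact, since
    \<open>i * n\<close> is at least \<open>i\<close>.\<close>
  have "i + (j + i * n - i) = j + i * n" using n by (cases n) auto
  then show "w (i + (j + i * n - i)) = w j" using w_per_mult by simp
qed

lemma range_w_finite: "finite (range w)"
proof -
  have "w i = w (i mod n)" for i
    using w_per_mult[of "i mod n" "i div n"] by simp
  then have "range w \<subseteq> w ` {..<n}" using n by fastforce
  then show ?thesis using finite_surj by blast
qed

lemma power_d: "x ^ d = x ^ (d - 1) * (x :: rat)"
  using d by (cases d) auto

lemma w_eq: "w i ^ (d - 1) * (w (Suc i) - b * w i) = a"
  using w_Suc[of i] w_nz[of i] by (simp add: field_simps)

definition t :: "nat \<Rightarrow> rat" where "t i = a / w i ^ d"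

lemma t_ratio: "w (Suc i) = (b + t i) * w i"
  using w_Suc[of i] w_nz[of i] by (simp add: t_def power_d field_simps)

lemma b_t_nz: "b + t i \<noteq> 0"
  using t_ratio[of i] w_nz[of "Suc i"] by auto

lemma t_nz: "t i \<noteq> 0"
  using a w_nz by (simp add: t_def)

lemma t_Suc: "t (Suc i) = t i / (b + t i) ^ d"
  unfolding t_def[of "Suc i"] t_ratio by (simp add: t_def power_mult_distrib mult.commute)

lemma w_prod: "w (i + k) = (\<Prod>j<k. b + t (i + j)) * w i"
  by (induction k) (auto simp: t_ratio)

section \<open>Integrality at a prime where \<open>b\<close> is a unit\<close>

context
  fixes q :: int
  assumes q: "prime q" and bR: "b \<in> local_ring q" "inverse b \<in> local_ring q"
begin

lemma t_ideal_Suc: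
  assumes "t i \<in> local_ideal q"
  shows "t (Suc i) \<in> local_ideal q"
proof -
  have "inverse (b + t i) \<in> local_ring q"
    using local_unit_add[OF q bR b assms] .
  then have "t i * inverse (b + t i) ^ d \<in> local_ideal q"
    using local_ideal_mult[OF q assms] local_ring_power[OF q] by blast
  then show ?thesis by (simp add: t_Suc divide_inverse power_inverse)
qed

text \<open>With s = 1/t in the ideal, t' = s^(d-1) / (1 + s b)^d, where 1 + s b is a unit. Since d
  \<ge> 2, one factor s can be split off, which puts t' into the ideal.\<close>

lemma t_pole_Suc:
  assumes "t i \<notin> local_ring q"
  shows "t (Suc i) \<in> local_ideal q"
proof -
  let ?s = "inverse (t i)"
  have s: "?s \<in> local_ideal q" using inverse_in_local_ideal[OF q assms] .
  have "?s * b \<in> local_ideal q" using local_ideal_mult[OF q s bR(1)] .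
  then have "inverse (1 + ?s * b) \<in> local_ring q"
    using local_unit_add[OF q, of 1] local_ring_1[OF q] by simp
  then have "?s * (?s ^ (d - 2) * inverse (1 + ?s * b) ^ d) \<in> local_ideal q"
    using s local_ideal_subset[OF q]
    by (intro local_ideal_mult[OF q] local_ring_mult[OF q] local_ring_power[OF q]) auto
  moreover have "t (Suc i) = ?s * (?s ^ (d - 2) * inverse (1 + ?s * b) ^ d)"
  proof -
    have "b + t i = t i * (1 + ?s * b)" using t_nz[of i] by (simp add: field_simps)
    then have "t (Suc i) = t i / (t i ^ d * (1 + ?s * b) ^ d)"
      by (simp add: t_Suc power_mult_distrib)
    moreover have "t i ^ d = t i * t i * t i ^ (d - 2)"
      using d by (metis le_add_diff_inverse mult.assoc power2_eq_square power_add)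
    ultimately show ?thesis using t_nz[of i]
      by (simp add: divide_inverse power_inverse)
  qed
  ultimately show ?thesis by simp
qed

text \<open>After a pole the sequence enters the ideal at once and stays there, yet periodicity
  would bring the pole back.\<close>

lemma t_local: "t i \<in> local_ring q"
proof (rule ccontr)
  assume *: "t i \<notin> local_ring q"
  have "t (i + Suc k) \<in> local_ideal q" for k
    by (induction k) (auto intro: t_pole_Suc[OF *] t_ideal_Suc)
  from this[of "n - 1"] have "t (i + n) \<in> local_ideal q" using n by simp
  then have "t i \<in> local_ideal q" by (simp add: t_def w_per)
  with * show False using local_ideal_subset[OF q] by auto
qed

text \<open>The ratio is a product of terms \<open>b + t\<close> along the way from \<open>i\<close>
  to \<open>j\<close>. Exchanging \<open>i\<close> and \<open>j\<close> gives the inverse ratio, so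
  all ratios are in fact units at \<open>q\<close>.\<close>

lemma w_ratio_local: "w j / w i \<in> local_ring q"
proof -
  obtain k where k: "w (i + k) = w j" using w_reach by blast
  have "w j / w i = (\<Prod>j<k. b + t (i + j))"
    using w_prod[of i k] w_nz[of i] by (simp flip: k)
  then show ?thesis
    using bR t_local by (auto intro!: local_ring_prod[OF q] local_ring_add[OF q])
qed

end

section \<open>Constancy of the absolute value along the cycle\<close>

lemma abs_w_const_if_unit:
  assumes "\<bar>b\<bar> = 1"
  shows "\<bar>w j\<bar> = \<bar>w i\<bar>"
proof -
  have "b = of_int 1 \<or> b = of_int (-1)" using assms by auto
  then have "b \<in> local_ring q" "inverse b \<in> local_ring q" if "prime q" for q
    using that local_ring_of_int[of q 1] local_ring_of_int[of q "-1"] by auto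
  then have "\<bar>w j / w i\<bar> = 1"
    by (intro abs_eq_1_if_local_unit) (auto intro: w_ratio_local simp: w_nz)
  then show ?thesis using w_nz[of i] by (simp add: abs_divide)
qed

lemma abs_w_const_if_gap:
  assumes B: "\<bar>b\<bar> \<ge> 2" and gap: "\<And>i j. \<bar>w j\<bar> < \<bar>w i\<bar> \<Longrightarrow> 2 * \<bar>w j\<bar> \<le> \<bar>w i\<bar>"
  shows "\<bar>w j\<bar> = \<bar>w i\<bar>"
proof -
  define M where "M = Max (abs ` range w)"
  have fin: "finite (abs ` range w)" using range_w_finite by blast
  have le_M: "\<bar>w i\<bar> \<le> M" for i unfolding M_def using fin by auto
  have "M \<in> abs ` range w" unfolding M_def using fin by (intro Max_in) auto
  then obtain i0 where i0: "\<bar>w i0\<bar> = M" by auto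
  have M_pos: "M > 0" using i0 w_nz[of i0] by auto
  have "\<bar>w k\<bar> = M" for k
  proof (rule ccontr)
    assume "\<bar>w k\<bar> \<noteq> M"
    then have m: "2 * \<bar>w k\<bar> \<le> M" using gap[of k i0] le_M[of k] i0 by auto
    \<comment> \<open>The constant \<bar>a\<bar> is bounded below through \<open>w_eq\<close> at the
      maximal point \<open>i\<close>, and above through \<open>w_eq\<close> at the small point
      \<open>k\<close>.\<close>
    have step: "\<bar>w (Suc i)\<bar> = M" if i: "\<bar>w i\<bar> = M" for i
    proof -
      have "M ^ (d - 1) * (\<bar>b\<bar> * M - \<bar>w (Suc i)\<bar>) \<le> M ^ (d - 1) * \<bar>w (Suc i) - b * w i\<bar>"
        using M_pos i abs_triangle_ineq2[of "b * w i" "w (Suc i)"]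
        by (intro mult_left_mono) (auto simp: abs_mult abs_minus_commute)
      also have "\<dots> = \<bar>a\<bar>"
        using arg_cong[OF w_eq[of i], of abs] by (simp add: abs_mult power_abs i)
      also have "\<dots> = \<bar>w k\<bar> ^ (d - 1) * \<bar>w (Suc k) - b * w k\<bar>"
        using arg_cong[OF w_eq[of k], of abs] by (simp add: abs_mult power_abs)
      also have "\<dots> \<le> (M ^ (d - 1) / 2) * (M + \<bar>b\<bar> * (M / 2))"
      proof (intro mult_mono)
        have "\<bar>w k\<bar> ^ (d - 1) \<le> (M / 2) ^ (d - 1)" using m by (intro power_mono) auto
        also have "\<dots> = M ^ (d - 1) / 2 ^ (d - 1)" by (simp add: power_divide)
        \<comment> \<open>Here d \<ge> 2 enters, through 2^(d-1) \<ge> 2.\<close>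
        also have "\<dots> \<le> M ^ (d - 1) / 2"
          using d M_pos self_le_power[of "2::rat" "d - 1"] by (intro divide_left_mono) auto
        finally show "\<bar>w k\<bar> ^ (d - 1) \<le> M ^ (d - 1) / 2" .
        have "\<bar>w (Suc k) - b * w k\<bar> \<le> \<bar>w (Suc k)\<bar> + \<bar>b\<bar> * \<bar>w k\<bar>"
          using abs_triangle_ineq4[of "w (Suc k)" "b * w k"] by (simp add: abs_mult)
        also have "\<dots> \<le> M + \<bar>b\<bar> * (M / 2)"
          using m le_M by (intro add_mono mult_left_mono) auto
        finally show "\<bar>w (Suc k) - b * w k\<bar> \<le> M + \<bar>b\<bar> * (M / 2)" .
      qed (use M_pos in auto)
      finally have "M ^ (d - 1) * (\<bar>b\<bar> * M - \<bar>w (Suc i)\<bar>)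
          \<le> M ^ (d - 1) * ((M + \<bar>b\<bar> * (M / 2)) / 2)" by simp
      then have "\<bar>b\<bar> * M - \<bar>w (Suc i)\<bar> \<le> (M + \<bar>b\<bar> * (M / 2)) / 2"
        using M_pos by (subst (asm) mult_le_cancel_left_pos) auto
      \<comment> \<open>The estimate says that \<bar>w (Suc i)\<bar> is at least (3/4) \<bar>b\<bar>
        M - M/2, and \<bar>b\<bar> \<ge> 2 makes this at least M.\<close>
      moreover have "2 * M \<le> \<bar>b\<bar> * M" using B M_pos by simp
      ultimately have "M \<le> \<bar>w (Suc i)\<bar>" by (simp add: field_simps)
      then show ?thesis using le_M[of "Suc i"] by simp
    qed
    \<comment> \<open>Maximality propagates forward from \<open>i0\<close>, and going forward
      reaches \<open>k\<close>.\<close>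
    have "\<bar>w (i0 + l)\<bar> = M" for l by (induction l) (auto simp: i0 step)
    then show False using w_reach[of i0 k] \<open>\<bar>w k\<bar> \<noteq> M\<close> by metis
  qed
  then show ?thesis by simp
qed

text \<open>For e = 0, \<open>b\<close> is a unit at every prime. For e > 0 only the prime
  \<open>p\<close> escapes control, and the ratios, being units elsewhere, have the gap
  required.\<close>

lemma abs_w_const:
  assumes p: "prime p" and bp: "b \<in> signed_powers p"
  shows "\<bar>w j\<bar> = \<bar>w i\<bar>"
proof -
  obtain \<sigma> e where be: "b = \<sigma> * of_nat p ^ e" "\<sigma> \<in> {1, -1}"
    using bp by (auto simp: signed_powers_def)
  then have ab: "\<bar>b\<bar> = of_nat p ^ e" by (auto simp: abs_mult)
  show ?thesis
  proof (cases "e = 0")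
    case True
    then show ?thesis using ab abs_w_const_if_unit by simp
  next
    case False
    have p2: "(of_nat p :: rat) \<ge> 2" using prime_ge_2_nat[OF p] by simp
    also have "\<dots> \<le> of_nat p ^ e" using False p2 by (intro self_le_power) auto
    finally have B: "\<bar>b\<bar> \<ge> 2" using ab by simp
    define bi :: int where "bi = (if \<sigma> = 1 then int p ^ e else - (int p ^ e))"
    have b_bi: "b = of_int bi" using be by (auto simp: bi_def)
    have bR: "b \<in> local_ring q" "inverse b \<in> local_ring q" if q: "prime q" "q \<noteq> int p" for q
    proof -
      have "\<not> q dvd int p" using q p primes_dvd_imp_eq[of q "int p"] by auto
      then have "\<not> q dvd bi" using q by (auto simp: bi_def dest: prime_dvd_power)
      then show "inverse b \<in> local_ring q"
        using local_ringI[of q bi 1] by (simp add: b_bi inverse_eq_divide)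
      show "b \<in> local_ring q" using local_ring_of_int[OF q(1)] b_bi by simp
    qed
    have pi: "prime (int p)" using p by simp
    show ?thesis
    proof (rule abs_w_const_if_gap[OF B])
      fix i j assume lt: "\<bar>w j\<bar> < \<bar>w i\<bar>"
      have "\<bar>w i / w j\<bar> \<ge> 2"
        using lt w_nz[of j] bR
        by (intro abs_ge_2_if_local_unit[OF pi]) (auto intro: w_ratio_local simp: abs_divide)
      then show "2 * \<bar>w j\<bar> \<le> \<bar>w i\<bar>" using w_nz[of j] by (simp add: abs_divide field_simps)
    qed
  qed
qed

section \<open>Signs along a cycle of constant absolute value\<close>

context
  assumes const: "\<And>i j. \<bar>w j\<bar> = \<bar>w i\<bar>"
begin

lemma w_Suc_pm: "w (Suc i) = w i \<or> w (Suc i) = - w i"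
  using const[of "Suc i" i] by (auto simp: abs_if split: if_splits)

lemma w_pm: "w i = w j \<or> w i = - w j"
  using const[of i j] by (auto simp: abs_if split: if_splits)

text \<open>For odd \<open>d\<close> the factor w^(d-1) ignores signs. A change from w to -w gives a
  = -(1 + b) w^d, the change back gives a = (1 + b) w^d, and so 2a = 0.\<close>

lemma odd_fixed:
  assumes "odd d"
  shows "w (Suc i) = w i"
proof (rule ccontr)
  assume ne: "w (Suc i) \<noteq> w i"
  then have neg: "w (Suc i) = - w i" using w_Suc_pm by blast
  have ev: "even (d - 1)" using assms d by simp
  \<comment> \<open>The sign must change back somewhere, at a point where \<open>w\<close> equals \<open>- w i\<close>.\<close>
  have "\<exists>k. w (Suc i + k) = - w i \<and> w (Suc (Suc i + k)) = w i"
  proof (rule ccontr)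
    assume "\<not> ?thesis"
    then have H: "w (Suc (Suc i + k)) = - w i" if "w (Suc i + k) = - w i" for k
      using that w_Suc_pm[of "Suc i + k"] by auto
    have "w (Suc i + k) = - w i" for k
      by (induction k) (use neg H in auto)
    then show False using w_reach[of "Suc i" i] w_nz[of i] by auto
  qed
  then obtain k where k: "w (Suc i + k) = - w i" "w (Suc (Suc i + k)) = w i" by blast
  have "w i ^ (d - 1) * (w i - b * (- w i)) = a"
    using w_eq[of "Suc i + k"] k ev by simp
  moreover have "w i ^ (d - 1) * (- w i - b * w i) = a"
    using w_eq[of i] neg by simp
  ultimately have "a + a = 0" by (simp add: algebra_simps)
  then show False using a by simp
qed

text \<open>For even \<open>d\<close> the power w^d is the same at all points. A step that keeps the
  sign gives a = (1 - b) w^d, one that changes it gives a = (-1 - b) w^d, so the two kinds cannot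
  coexist.\<close>

lemma even_sign_const:
  assumes "even d" "w (Suc i) \<noteq> w i"
  shows "w (Suc j) = - w j"
proof (rule ccontr)
  assume "w (Suc j) \<noteq> - w j"
  then have "w (Suc j) = w j" using w_Suc_pm by blast
  then have "w j ^ d * (1 - b) = a" using w_eq[of j] by (simp add: power_d algebra_simps)
  moreover have "w j ^ d = w i ^ d" using w_pm[of j i] assms by auto
  moreover have "w i ^ d * (-1 - b) = a"
    using w_eq[of i] w_Suc_pm[of i] assms by (simp add: power_d algebra_simps)
  ultimately have "w i ^ d * (1 - b) = w i ^ d * (-1 - b)" by simp
  then show False using w_nz[of i] by simp
qed

end

end

section \<open>Periodic points on the projective line\<close>

lemma affine_pt_inject: "affine_pt z = affine_pt z' \<longleftrightarrow> z = z'"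
  by transfer (auto simp: proj_rel_def)

lemma proj_line_cases:
  obtains (affine) z where "P = affine_pt z" | (infinity) "P = infinity_pt"
proof -
  have "(\<exists>z. P = affine_pt z) \<or> P = infinity_pt"
  proof (transfer)
    fix P :: "'a \<times> 'a" assume "proj_rel P P"
    then obtain X Y where P: "P = (X, Y)" "X \<noteq> 0 \<or> Y \<noteq> 0" by (cases P) (auto simp: proj_rel_def)
    show "(\<exists>z. proj_rel P (z, 1)) \<or> proj_rel P (1, 0)"
    proof (cases "Y = 0")
      case True
      then have "proj_rel P (1, 0)"
        using P by (auto simp: proj_rel_def intro!: exI[of _ "inverse X"])
      then show ?thesis ..
    next
      case False
      then have "proj_rel P (X / Y, 1)"
        using P by (auto simp: proj_rel_def intro!: exI[of _ "inverse Y"] simp: divide_inverse)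
      then show ?thesis by blast
    qed
  qed
  then show ?thesis using that by blast
qed

text \<open>The point 0 is fixed, infinity maps to 0, and the poles map to infinity. A periodic
  orbit that meets any of these is therefore the fixed point 0, and every other one lives in the
  coordinate 1/z.\<close>

lemma nonfixed_periodic_orbit:
  fixes a b :: rat
  assumes d: "d \<ge> 2" and a: "a \<noteq> 0" and b: "b \<noteq> 0" and n: "n \<ge> 1"
    and per: "(psi d a b ^^ n) P = P" and nf: "psi d a b P \<noteq> P"
  obtains w where "reciprocal_cycle d n a b w"
    "\<And>k. (psi d a b ^^ k) P = affine_pt (inverse (w k))"
proof -
  let ?f = "psi d a b"
  have f0: "?f (affine_pt 0) = affine_pt 0"
    using psi_affine_pt[OF d a b, of 0] d b by (simp add: power_0_left)
  have perk: "(?f ^^ (k * n)) P = P" for k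
  proof (induction k)
    case (Suc k)
    have "(?f ^^ (Suc k * n)) P = (?f ^^ n) ((?f ^^ (k * n)) P)" by (simp add: funpow_add)
    then show ?case using Suc per by simp
  qed simp
  have not0: "(?f ^^ k) P \<noteq> affine_pt 0" for k
  proof
    assume k: "(?f ^^ k) P = affine_pt 0"
    have "(?f ^^ (l + k)) P = affine_pt 0" for l by (induction l) (auto simp: k f0)
    \<comment> \<open>At time \<open>k * n\<close>, which is at least \<open>k\<close>, the orbit is
      back at \<open>P\<close> and already absorbed by 0.\<close>
    moreover have "k * n - k + k = k * n" using n by (cases n) auto
    ultimately have "P = affine_pt 0" using perk[of k] by metis
    then show False using f0 nf by simp
  qed
  have "\<exists>z. (?f ^^ k) P = affine_pt z" for k
  proof (cases "(?f ^^ k) P" rule: proj_line_cases)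
    case infinity
    then have "(?f ^^ Suc k) P = affine_pt 0" using psi_infinity_pt[OF d a b] by simp
    then show ?thesis using not0 by blast
  qed blast
  then obtain z where z: "\<And>k. (?f ^^ k) P = affine_pt (z k)" by metis
  have z_nz: "z k \<noteq> 0" for k using not0[of k] z by auto
  have den: "a * z k ^ d + b \<noteq> 0" for k
  proof
    assume "a * z k ^ d + b = 0"
    then have "(?f ^^ Suc k) P = infinity_pt" using psi_pole[OF d a b] z[of k] by simp
    then have "(?f ^^ Suc (Suc k)) P = affine_pt 0" using psi_infinity_pt[OF d a b] by simp
    then show False using not0 by blast
  qed
  have z_Suc: "z (Suc k) = z k / (a * z k ^ d + b)" for k
    using psi_affine_pt[OF d a b den[of k]] z[of k] z[of "Suc k"] by (simp add: affine_pt_inject)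
  have z_per: "z (k + n) = z k" for k
    using z[of "k + n"] z[of k] per by (simp add: funpow_add affine_pt_inject)
  show thesis
  proof (rule that[of "\<lambda>k. inverse (z k)"])
    show "reciprocal_cycle d n a b (\<lambda>k. inverse (z k))"
    proof
      fix i
      have "z i ^ d = z i ^ (d - 1) * z i" using d by (cases d) auto
      then show "inverse (z (Suc i)) = b * inverse (z i) + a / inverse (z i) ^ (d - 1)"
        using z_nz[of i] by (simp add: z_Suc field_simps)
    qed (use assms z_nz z_per in auto)
  qed (simp add: z)
qed

theorem theorem2p8:
  fixes p d :: nat and a b :: rat
  assumes "prime p" and "d \<ge> 2" and "a \<noteq> 0" and "b \<in> signed_powers p"
  shows "(odd d \<longrightarrow>
            (\<forall>P :: rat proj_line. periodic_point (psi d a b) P \<longrightarrow> psi d a b P = P)) \<and>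
         (even d \<longrightarrow>
            (\<forall>n C. periodic_cycle (psi d a b) n C \<longrightarrow> n \<le> 2) \<and>
            (\<forall>C. periodic_cycle (psi d a b) 2 C \<longrightarrow>
               (\<exists>z :: rat. C = {affine_pt z, affine_pt (- z)} \<and>
                  psi d a b (affine_pt z) = affine_pt (- z) \<and>
                  psi d a b (affine_pt (- z)) = affine_pt z)))"
proof -
  let ?f = "psi d a b"
  have b: "b \<noteq> 0" using assms(1,4) prime_gt_0_nat by (fastforce simp: signed_powers_def)
  have odd: "?f P = P" if par: "odd d" and P: "periodic_point ?f P" for P
  proof (rule ccontr)
    assume nf: "?f P \<noteq> P"
    obtain n where "n \<ge> 1" "(?f ^^ n) P = P" using P by (auto simp: periodic_point_def)
    then obtain w where rc: "reciprocal_cycle d n a b w"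
      and w: "\<And>k. (?f ^^ k) P = affine_pt (inverse (w k))"
      using nonfixed_periodic_orbit[OF assms(2,3) b _ _ nf] by metis
    interpret reciprocal_cycle d n a b w by (rule rc)
    have "w (Suc 0) = w 0"
      by (rule odd_fixed[OF abs_w_const[OF assms(1,4)] par])
    then show False using w[of 0] w[of "Suc 0"] nf by simp
  qed
  \<comment> \<open>Stated for every exact period of at least 2, this yields both the bound on the
    length and the shape of the 2-cycles.\<close>
  have even: "\<exists>z. P = affine_pt z \<and> ?f (affine_pt z) = affine_pt (- z) \<and>
      ?f (affine_pt (- z)) = affine_pt z"
    if par: "even d" and P: "exact_period ?f P n" and n: "n \<ge> 2" for P n
  proof -
    have nf: "?f P \<noteq> P" and "n \<ge> 1" "(?f ^^ n) P = P"
      using P n by (auto simp: exact_period_def dest: spec[of _ 1])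
    then obtain w where rc: "reciprocal_cycle d n a b w"
      and w: "\<And>k. (?f ^^ k) P = affine_pt (inverse (w k))"
      using nonfixed_periodic_orbit[OF assms(2,3) b] by metis
    interpret reciprocal_cycle d n a b w by (rule rc)
    have "w (Suc 0) \<noteq> w 0" using w[of 0] w[of "Suc 0"] nf by auto
    then have "w (Suc j) = - w j" for j
      by (rule even_sign_const[OF abs_w_const[OF assms(1,4)] par])
    then show ?thesis using w[of 0] w[of 1] w[of 2]
      by (intro exI[of _ "inverse (w 0)"]) (auto simp: numeral_2_eq_2)
  qed
  have "n \<le> 2" if par: "even d" and C: "periodic_cycle ?f n C" for n C
  proof (rule ccontr)
    assume n: "\<not> n \<le> 2"
    obtain P where P: "exact_period ?f P n" using C by (auto simp: periodic_cycle_def)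
    \<comment> \<open>The points z and -z are exchanged, so two steps lead back to \<open>P\<close>,
      too early for an exact period above 2.\<close>
    then have "(?f ^^ 2) P = P" using even[OF par P] n by (auto simp: numeral_2_eq_2)
    then show False using P n by (auto simp: exact_period_def)
  qed
  moreover have "\<exists>z. C = {affine_pt z, affine_pt (- z)} \<and>
      ?f (affine_pt z) = affine_pt (- z) \<and> ?f (affine_pt (- z)) = affine_pt z"
    if par: "even d" and C: "periodic_cycle ?f 2 C" for C
  proof -
    obtain P where P: "exact_period ?f P 2" and C': "C = {(?f ^^ k) P | k. True}"
      using C by (auto simp: periodic_cycle_def)
    obtain z where z: "P = affine_pt z" "?f (affine_pt z) = affine_pt (- z)"
        "?f (affine_pt (- z)) = affine_pt z"
      using even[OF par P] by auto
    have "(?f ^^ k) P \<in> {affine_pt z, affine_pt (- z)}" for k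
      by (induction k) (auto simp: z)
    moreover have "affine_pt z = (?f ^^ 0) P" "affine_pt (- z) = (?f ^^ 1) P"
      by (auto simp: z)
    ultimately have "C = {affine_pt z, affine_pt (- z)}" unfolding C' by blast
    then show ?thesis using z by blast
  qed
  ultimately show ?thesis using odd by blast
qed

end
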